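(* Let $A$ be a ring and let $X$ be a $\Sigma$-Rickart $A$-module that is also a $\Sigma$-$\operatorname{C2}$ module. Then $X$ is $\Sigma$-d-Rickart.
   Context: Rings are associative with unity and modules are unital right $A$-modules. $X^{(\Lambda)}$ denotes the direct sum of $\Lambda$ copies of $X$, for a non-empty index set $\Lambda$. A module $M$ is Rickart (respectively d-Rickart) if $\operatorname{Ker}(\phi)$ (respectively $\operatorname{Im}(\phi)$) is a direct summand of $M$ for every $\phi\in\operatorname{End}_A(M)$. A module $M$ is a $\operatorname{C2}$-module if every submodule of $M$ that is isomorphic to a direct summand of $M$ is itself a direct summand of $M$. A module $X$ is $\Sigma$-Rickart (respectively $\Sigma$-d-Rickart, $\Sigma$-$\operatorname{C2}$) if $X^{(\Lambda)}$ is Rickart (respectively d-Rickart, a $\operatorname{C2}$-module) for every non-empty index set $\Lambda$. *)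

theory Defs
  imports "HOL-Algebra.Module" "HOL-Algebra.AbelCoset"
begin

text \<open>
  Right modules over a not necessarily commutative ring (the library locale \<open>module\<close> assumes
  \<open>cring\<close>). The library record is reused, so the scalar is written on the left:
  \<open>a \<odot>\<^bsub>M\<^esub> x\<close> stands for the right action \<open>x \<cdot> a\<close>, whence the reversed order in
  \<open>smult_assoc\<close>.
\<close>

locale right_module = R?: ring R + M?: abelian_group M
  for R :: "('a, 'r) ring_scheme" (structure) and M :: "('a, 'b, 'm) module_scheme" (structure) +
  assumes smult_closed [simp, intro]:
      "\<lbrakk>a \<in> carrier R; x \<in> carrier M\<rbrakk> \<Longrightarrow> a \<odot>\<^bsub>M\<^esub> x \<in> carrier M"
    and smult_l_distr:
      "\<lbrakk>a \<in> carrier R; b \<in> carrier R; x \<in> carrier M\<rbrakk> \<Longrightarrow>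
        (a \<oplus> b) \<odot>\<^bsub>M\<^esub> x = a \<odot>\<^bsub>M\<^esub> x \<oplus>\<^bsub>M\<^esub> b \<odot>\<^bsub>M\<^esub> x"
    and smult_r_distr:
      "\<lbrakk>a \<in> carrier R; x \<in> carrier M; y \<in> carrier M\<rbrakk> \<Longrightarrow>
        a \<odot>\<^bsub>M\<^esub> (x \<oplus>\<^bsub>M\<^esub> y) = a \<odot>\<^bsub>M\<^esub> x \<oplus>\<^bsub>M\<^esub> a \<odot>\<^bsub>M\<^esub> y"
    and smult_assoc:
      "\<lbrakk>a \<in> carrier R; b \<in> carrier R; x \<in> carrier M\<rbrakk> \<Longrightarrow>
        (a \<otimes> b) \<odot>\<^bsub>M\<^esub> x = b \<odot>\<^bsub>M\<^esub> (a \<odot>\<^bsub>M\<^esub> x)"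
    and smult_one [simp]:
      "x \<in> carrier M \<Longrightarrow> \<one> \<odot>\<^bsub>M\<^esub> x = x"

text \<open>Homomorphisms are only constrained on the carrier.\<close>

definition mod_homs ::
  "('a, 'r) ring_scheme \<Rightarrow> ('a, 'b, 'm) module_scheme \<Rightarrow> ('a, 'c, 'n) module_scheme \<Rightarrow> ('b \<Rightarrow> 'c) set"
  where "mod_homs A M N =
    {f \<in> hom (add_monoid M) (add_monoid N).
       \<forall>a \<in> carrier A. \<forall>x \<in> carrier M. f (a \<odot>\<^bsub>M\<^esub> x) = a \<odot>\<^bsub>N\<^esub> f x}"

definition mod_isomorphic ::
  "('a, 'r) ring_scheme \<Rightarrow> ('a, 'b, 'm) module_scheme \<Rightarrow> ('a, 'c, 'n) module_scheme \<Rightarrow> bool"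
  where "mod_isomorphic A M N \<longleftrightarrow> (\<exists>f \<in> mod_homs A M N. bij_betw f (carrier M) (carrier N))"

definition direct_summand ::
  "('a, 'r) ring_scheme \<Rightarrow> ('a, 'b, 'm) module_scheme \<Rightarrow> 'b set \<Rightarrow> bool"
  where "direct_summand A M N \<longleftrightarrow> submodule N A M \<and>
    (\<exists>K. submodule K A M \<and> N \<inter> K = {\<zero>\<^bsub>M\<^esub>} \<and> N <+>\<^bsub>M\<^esub> K = carrier M)"

definition rickart :: "('a, 'r) ring_scheme \<Rightarrow> ('a, 'b, 'm) module_scheme \<Rightarrow> bool"
  where "rickart A M \<longleftrightarrow> (\<forall>f \<in> mod_homs A M M. direct_summand A M (a_kernel M M f))"

definition d_rickart :: "('a, 'r) ring_scheme \<Rightarrow> ('a, 'b, 'm) module_scheme \<Rightarrow> bool"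
  where "d_rickart A M \<longleftrightarrow> (\<forall>f \<in> mod_homs A M M. direct_summand A M (f ` carrier M))"

definition C2_module :: "('a, 'r) ring_scheme \<Rightarrow> ('a, 'b, 'm) module_scheme \<Rightarrow> bool"
  where "C2_module A M \<longleftrightarrow>
    (\<forall>N D. submodule N A M \<and> direct_summand A M D \<and>
       mod_isomorphic A (M\<lparr>carrier := N\<rparr>) (M\<lparr>carrier := D\<rparr>) \<longrightarrow> direct_summand A M N)"

text \<open>
  \<open>direct_power I X\<close> is the direct sum of \<open>I\<close> copies of \<open>X\<close>: the finitely supported families
  indexed by \<open>I\<close>, extensional outside \<open>I\<close>. The ring fields \<open>mult\<close> and \<open>one\<close> of the record
  play no role for modules.
\<close>

definition direct_power :: "'i set \<Rightarrow> ('a, 'b, 'm) module_scheme \<Rightarrow> ('a, 'i \<Rightarrow> 'b) module"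
  where "direct_power I X =
    \<lparr>carrier = {x \<in> I \<rightarrow>\<^sub>E carrier X. finite {i \<in> I. x i \<noteq> \<zero>\<^bsub>X\<^esub>}},
     mult = undefined,
     one = undefined,
     zero = (\<lambda>i\<in>I. \<zero>\<^bsub>X\<^esub>),
     add = (\<lambda>x y. \<lambda>i\<in>I. x i \<oplus>\<^bsub>X\<^esub> y i),
     smult = (\<lambda>a x. \<lambda>i\<in>I. a \<odot>\<^bsub>X\<^esub> x i)\<rparr>"

text \<open>
  HOL cannot quantify over all types inside a definition, so the type \<open>'i\<close> from which the index
  sets are drawn is a parameter of the \<open>\<Sigma>\<close>-notions; it is arbitrary.
\<close>

definition Sigma_rickart ::
  "'i itself \<Rightarrow> ('a, 'r) ring_scheme \<Rightarrow> ('a, 'b, 'm) module_scheme \<Rightarrow> bool"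
  where "Sigma_rickart T A X \<longleftrightarrow> (\<forall>I :: 'i set. I \<noteq> {} \<longrightarrow> rickart A (direct_power I X))"

definition Sigma_d_rickart ::
  "'i itself \<Rightarrow> ('a, 'r) ring_scheme \<Rightarrow> ('a, 'b, 'm) module_scheme \<Rightarrow> bool"
  where "Sigma_d_rickart T A X \<longleftrightarrow> (\<forall>I :: 'i set. I \<noteq> {} \<longrightarrow> d_rickart A (direct_power I X))"

definition Sigma_C2 ::
  "'i itself \<Rightarrow> ('a, 'r) ring_scheme \<Rightarrow> ('a, 'b, 'm) module_scheme \<Rightarrow> bool"
  where "Sigma_C2 T A X \<longleftrightarrow> (\<forall>I :: 'i set. I \<noteq> {} \<longrightarrow> C2_module A (direct_power I X))"

end

theory Submission
  imports Defs
begin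

text \<open>
  If \<open>K\<close> is a complement of \<open>Ker f\<close>, then \<open>f\<close> restricts to an isomorphism from the direct summand
  \<open>K\<close> onto \<open>Im f\<close>, so \<open>Im f\<close> is a direct summand by the C2 condition.
\<close>

text \<open>The module laws hold coordinatewise, so only finiteness of supports needs an argument:
  the support of a sum lies in the union of the two supports, and scalars and negation do not
  enlarge a support.\<close>

lemma right_module_direct_power:
  assumes "right_module A X"
  shows "right_module A (direct_power I X)"
proof -
  interpret right_module A X by fact
  let ?P = "direct_power I X"
  note simps = direct_power_def PiE_iff extensional_def
  have finite_add: "finite {i \<in> I. x i \<oplus>\<^bsub>X\<^esub> y i \<noteq> \<zero>\<^bsub>X\<^esub>}"
    if "x \<in> carrier ?P" "y \<in> carrier ?P" for x y
    by (rule finite_subset[of _ "{i \<in> I. x i \<noteq> \<zero>\<^bsub>X\<^esub>} \<union> {i \<in> I. y i \<noteq> \<zero>\<^bsub>X\<^esub>}"])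
      (use that in \<open>auto simp: simps\<close>)
  \<comment> \<open>Additivity of the action gives \<open>a0 = a0 + a0\<close>, and cancelling
    leaves \<open>a0 = 0\<close>. This is what keeps the support of a scalar multiple inside the old
    one.\<close>
  have smult_zero: "a \<odot>\<^bsub>X\<^esub> \<zero>\<^bsub>X\<^esub> = \<zero>\<^bsub>X\<^esub>" if "a \<in> carrier A" for a
    using smult_r_distr[OF that M.zero_closed M.zero_closed] that
    by (metis M.add.r_cancel_one' M.r_zero M.zero_closed smult_closed)
  have finite_smult: "finite {i \<in> I. a \<odot>\<^bsub>X\<^esub> x i \<noteq> \<zero>\<^bsub>X\<^esub>}"
    if "a \<in> carrier A" "x \<in> carrier ?P" for a x
    by (rule finite_subset[of _ "{i \<in> I. x i \<noteq> \<zero>\<^bsub>X\<^esub>}"])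
      (use that in \<open>auto simp: simps smult_zero\<close>)
  have "abelian_group ?P"
  proof (rule abelian_groupI)
    fix x y assume "x \<in> carrier ?P" "y \<in> carrier ?P"
    \<comment> \<open>With \<open>conj_cong\<close>, the conjunct \<open>i \<in> I\<close> in the
      support set is available for evaluating the restricted family at \<open>i\<close>.\<close>
    then show "x \<oplus>\<^bsub>?P\<^esub> y \<in> carrier ?P"
      using finite_add[of x y] by (auto simp: simps cong: conj_cong)
  next
    fix x assume x: "x \<in> carrier ?P"
    have "(\<lambda>i\<in>I. \<ominus>\<^bsub>X\<^esub> x i) \<in> carrier ?P"
    proof -
      have "{i \<in> I. \<ominus>\<^bsub>X\<^esub> x i \<noteq> \<zero>\<^bsub>X\<^esub>} \<subseteq> {i \<in> I. x i \<noteq> \<zero>\<^bsub>X\<^esub>}" by auto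
      then have "finite {i \<in> I. \<ominus>\<^bsub>X\<^esub> x i \<noteq> \<zero>\<^bsub>X\<^esub>}"
        using x by (auto simp: simps intro: finite_subset)
      then show ?thesis using x by (auto simp: simps cong: conj_cong)
    qed
    moreover have "(\<lambda>i\<in>I. \<ominus>\<^bsub>X\<^esub> x i) \<oplus>\<^bsub>?P\<^esub> x = \<zero>\<^bsub>?P\<^esub>"
      using x by (auto simp: simps fun_eq_iff M.l_neg)
    ultimately show "\<exists>y\<in>carrier ?P. y \<oplus>\<^bsub>?P\<^esub> x = \<zero>\<^bsub>?P\<^esub>" by blast
  qed (auto simp: simps fun_eq_iff M.a_ac cong: conj_cong)
  moreover have "a \<odot>\<^bsub>?P\<^esub> x \<in> carrier ?P" if "a \<in> carrier A" "x \<in> carrier ?P" for a x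
    using that finite_smult[of a x] by (auto simp: simps cong: conj_cong)
  ultimately show ?thesis
    by (intro right_module.intro right_module_axioms.intro R.ring_axioms)
      (auto simp: simps fun_eq_iff smult_l_distr smult_r_distr smult_assoc)
qed

text \<open>The complement provided by the definition is only known to be a submodule. The two
  conditions on the pair are symmetric, so it is itself a summand, which is the form the C2
  condition asks for.\<close>

lemma direct_summand_complement:
  assumes "right_module A M" "direct_summand A M N"
  obtains K where "direct_summand A M K" "N \<inter> K = {\<zero>\<^bsub>M\<^esub>}" "N <+>\<^bsub>M\<^esub> K = carrier M"
proof -
  interpret right_module A M by fact
  from assms(2) obtain K where K: "submodule N A M" "submodule K A M"
      "N \<inter> K = {\<zero>\<^bsub>M\<^esub>}" "N <+>\<^bsub>M\<^esub> K = carrier M"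
    unfolding direct_summand_def by blast
  have sub: "N \<subseteq> carrier M" "K \<subseteq> carrier M"
    using K(1,2) by (auto simp: submodule_def subgroup_def)
  have "n \<oplus>\<^bsub>M\<^esub> k = k \<oplus>\<^bsub>M\<^esub> n" if "n \<in> N" "k \<in> K" for n k
    using sub that by (intro M.a_comm) auto
  \<comment> \<open>As a double union of singletons, the sum of sets is symmetric once the unions
    are swapped and addition commutes.\<close>
  then have "K <+>\<^bsub>M\<^esub> N = N <+>\<^bsub>M\<^esub> K"
    unfolding set_add_def' by (subst SUP_commute) (intro SUP_cong refl, simp)
  with K have "direct_summand A M K"
    unfolding direct_summand_def by (metis Int_commute)
  with K show thesis using that by blast
qed

lemma submodule_image:
  assumes "right_module A M" "right_module A N" "f \<in> mod_homs A M N"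
  shows "submodule (f ` carrier M) A N"
proof -
  interpret M: right_module A M by fact
  interpret N: right_module A N by fact
  interpret f: group_hom "add_monoid M" "add_monoid N" f
    using assms(3) M.M.a_group N.M.a_group
    by (auto simp: group_hom_def group_hom_axioms_def mod_homs_def)
  have "a \<odot>\<^bsub>N\<^esub> f x \<in> f ` carrier M" if "a \<in> carrier A" "x \<in> carrier M" for a x
  proof -
    have "f (a \<odot>\<^bsub>M\<^esub> x) = a \<odot>\<^bsub>N\<^esub> f x" using assms(3) that by (simp add: mod_homs_def)
    then show ?thesis using that by (metis M.smult_closed image_eqI)
  qed
  with f.img_is_subgroup show ?thesis
    by (auto simp: submodule_def submodule_axioms_def)
qed

text \<open>C2 expects an isomorphism from the submodule to the summand, so the inverse of
  \<open>f\<close> restricted to \<open>K\<close> is needed. It is linear because \<open>f\<close>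
  is linear on \<open>K\<close> and \<open>K\<close> is closed under the operations.\<close>

lemma mod_isomorphic_image:
  assumes "right_module A M" "f \<in> mod_homs A M M" "submodule K A M"
    and inj: "inj_on f K" and img: "f ` K = L"
  shows "mod_isomorphic A (M\<lparr>carrier := L\<rparr>) (M\<lparr>carrier := K\<rparr>)"
proof -
  interpret right_module A M by fact
  have K: "K \<subseteq> carrier M" "\<And>x y. x \<in> K \<Longrightarrow> y \<in> K \<Longrightarrow> x \<oplus>\<^bsub>M\<^esub> y \<in> K"
    "\<And>a x. a \<in> carrier A \<Longrightarrow> x \<in> K \<Longrightarrow> a \<odot>\<^bsub>M\<^esub> x \<in> K"
    using assms(3) by (auto simp: submodule_def submodule_axioms_def subgroup_def)
  have f: "f (x \<oplus>\<^bsub>M\<^esub> y) = f x \<oplus>\<^bsub>M\<^esub> f y" "a \<in> carrier A \<Longrightarrow> f (a \<odot>\<^bsub>M\<^esub> x) = a \<odot>\<^bsub>M\<^esub> f x"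
    if "x \<in> K" "y \<in> K" for x y a
    using assms(2) that[THEN subsetD[OF K(1)]] by (auto simp: mod_homs_def hom_def)
  \<comment> \<open>The inverse is taken relative to \<open>K\<close>, since \<open>f\<close> may
    fail to be injective on the whole of \<open>M\<close>.\<close>
  define g where "g = inv_into K f"
  have g: "g (f x) = x" if "x \<in> K" for x
    unfolding g_def using that inj by simp
  have "g (f x \<oplus>\<^bsub>M\<^esub> f y) = x \<oplus>\<^bsub>M\<^esub> y" if "x \<in> K" "y \<in> K" for x y
    using g[OF K(2)[OF that]] f(1)[OF that] by simp
  \<comment> \<open>The fact \<open>f\<close> carries premises for two elements of \<open>K\<close>,
    even in its scalar part; \<open>x\<close> fills both.\<close>
  moreover have "g (a \<odot>\<^bsub>M\<^esub> f x) = a \<odot>\<^bsub>M\<^esub> x" if "a \<in> carrier A" "x \<in> K" for a x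
    using g[OF K(3)[OF that]] f(2)[OF that(2,2,1)] by simp
  \<comment> \<open>Rewriting \<open>L\<close> as the image of \<open>K\<close> gives each of its
    elements the form \<open>f x\<close> to which the equations for \<open>g\<close> apply.\<close>
  ultimately have "g \<in> mod_homs A (M\<lparr>carrier := L\<rparr>) (M\<lparr>carrier := K\<rparr>)"
    using g img[symmetric] by (auto simp: mod_homs_def hom_def)
  moreover have "bij_betw g L K"
    unfolding g_def using inj img by (intro bij_betw_inv_into) (simp add: bij_betw_def)
  ultimately show ?thesis by (auto simp: mod_isomorphic_def)
qed

lemma rickart_C2_imp_d_rickart:
  assumes M: "right_module A M" and "rickart A M" and "C2_module A M"
  shows "d_rickart A M"
  unfolding d_rickart_def
proof
  fix f assume f: "f \<in> mod_homs A M M"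
  interpret right_module A M by fact
  interpret f: group_hom "add_monoid M" "add_monoid M" f
    using f M.a_group by (auto simp: group_hom_def group_hom_axioms_def mod_homs_def)
  define N where "N = a_kernel M M f"
  have N: "x \<in> N \<longleftrightarrow> x \<in> carrier M \<and> f x = \<zero>\<^bsub>M\<^esub>" for x
    by (auto simp: N_def a_kernel_def kernel_def)
  have "direct_summand A M N"
    using assms(2) f by (simp add: rickart_def N_def)
  with M obtain K where K: "direct_summand A M K" "N \<inter> K = {\<zero>\<^bsub>M\<^esub>}" "N <+>\<^bsub>M\<^esub> K = carrier M"
    by (rule direct_summand_complement)
  then have sub: "submodule K A M" by (simp add: direct_summand_def)
  then have grp: "subgroup K (add_monoid M)" by (simp add: submodule_def)
  then have KM: "K \<subseteq> carrier M" by (auto simp: subgroup_def)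
  \<comment> \<open>If \<open>f x = f y\<close>, the difference of \<open>x\<close> and
    \<open>y\<close> lies in both \<open>K\<close> and the kernel, which meet only in zero.\<close>
  have "inj_on f K"
  proof (rule inj_onI)
    fix x y assume xy: "x \<in> K" "y \<in> K" "f x = f y"
    then have c: "x \<in> carrier M" "y \<in> carrier M" using KM by auto
    have "x \<ominus>\<^bsub>M\<^esub> y \<in> K"
      using grp xy subgroup.m_closed[OF grp] subgroup.m_inv_closed[OF grp]
      by (simp add: a_minus_def a_inv_def)
    moreover have "f (x \<ominus>\<^bsub>M\<^esub> y) = \<zero>\<^bsub>M\<^esub>"
      using c xy(3) f.hom_mult[of x "\<ominus>\<^bsub>M\<^esub> y"] f.hom_inv[of y] f.hom_closed[of y]
      by (simp add: a_minus_def a_inv_def[symmetric] M.r_neg)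
    ultimately have "x \<ominus>\<^bsub>M\<^esub> y \<in> N \<inter> K" using c by (simp add: N)
    then have "x \<oplus>\<^bsub>M\<^esub> \<ominus>\<^bsub>M\<^esub> y = \<zero>\<^bsub>M\<^esub>" using K(2) by (simp add: a_minus_def)
    \<comment> \<open>By uniqueness of negatives, \<open>x\<close> is the negative of the negative
      of \<open>y\<close>.\<close>
    then show "x = y" using M.minus_equality[of x "\<ominus>\<^bsub>M\<^esub> y"] c by simp
  qed
  \<comment> \<open>Every element of \<open>M\<close> is a sum of some \<open>n\<close> in the
    kernel and some \<open>k\<close> in \<open>K\<close>, and \<open>f\<close> sends it to
    \<open>f k\<close>.\<close>
  moreover have "f ` K = f ` carrier M"
  proof
    show "f ` carrier M \<subseteq> f ` K"
    proof
      fix z assume "z \<in> f ` carrier M"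
      then obtain n k where nk: "n \<in> N" "k \<in> K" "z = f (n \<oplus>\<^bsub>M\<^esub> k)"
        unfolding K(3)[symmetric] set_add_def' by auto
      then have "z = f k"
        using KM f.hom_mult[of n k] f.hom_closed[of k] by (auto simp: N)
      then show "z \<in> f ` K" using nk by blast
    qed
  qed (use KM in blast)
  ultimately have "mod_isomorphic A (M\<lparr>carrier := f ` carrier M\<rparr>) (M\<lparr>carrier := K\<rparr>)"
    by (rule mod_isomorphic_image[OF M f sub])
  with K(1) submodule_image[OF M M f] assms(3) show "direct_summand A M (f ` carrier M)"
    unfolding C2_module_def by blast
qed

theorem proposition4p3:
  fixes A :: "('a, 'r) ring_scheme" and X :: "('a, 'b, 'm) module_scheme"
  assumes "ring A"
    and "right_module A X"
    and "Sigma_rickart TYPE('i) A X"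
    and "Sigma_C2 TYPE('i) A X"
  shows "Sigma_d_rickart TYPE('i) A X"
  \<comment> \<open>Hypotheses and conclusion range over the same index sets, so the result for a
    single module applies to each direct power separately.\<close>
  using assms(3,4) rickart_C2_imp_d_rickart[OF right_module_direct_power[OF assms(2)]]
  unfolding Sigma_rickart_def Sigma_C2_def Sigma_d_rickart_def by blast

end
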